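(* Let $k,n\ge 1$ be integers. (Invariant case.) The real vector space of invariant linear maps $L:\mathbb{R}^{n^k}\to\mathbb{R}$ has dimension $\mathrm{b}(k)$, and a basis is given by the tensors $B^{\gamma}\in\mathbb{R}^{n^k}$, $\gamma\in[n]^k/_\sim$, where $B^\gamma$ represents the linear map $A\mapsto\sum_{a\in[n]^k}B^\gamma_a A_a$. (Equivariant case.) The real vector space of equivariant linear maps $L:\mathbb{R}^{n^k}\to\mathbb{R}^{n^k}$ has dimension $\mathrm{b}(2k)$, and a basis is given by the tensors $B^{\gamma}\in\mathbb{R}^{n^{2k}}$, $\gamma\in[n]^{2k}/_\sim$, where $B^\gamma$ represents the linear map $A\mapsto L(A)$, $L(A)_b=\sum_{a\in[n]^k}B^\gamma_{(a,b)}A_a$ for $b\in[n]^k$.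
   Context: $[n]=\{1,\dots,n\}$, and $\mathbb{R}^{n^k}$ denotes the space of real order-$k$ tensors $A=(A_a)_{a\in[n]^k}$. A permutation $p$ of $[n]$, with permutation matrix $P$, acts on $\mathbb{R}^{n^k}$ by the reordering operator $P\star$: the $(p(i_1),\dots,p(i_k))$-th entry of $P\star A$ equals the $(i_1,\dots,i_k)$-th entry of $A$. A linear map $L:\mathbb{R}^{n^k}\to\mathbb{R}$ is invariant if $L(P\star A)=L(A)$ for all $A$ and all permutation matrices $P$; a linear map $L:\mathbb{R}^{n^k}\to\mathbb{R}^{n^k}$ is equivariant if $L(P\star A)=P\star L(A)$ for all $A$ and all permutation matrices $P$. For $\ell\ge 1$, multi-indices $a,b\in[n]^\ell$ satisfy $a\sim b$ iff they have the same equality pattern: $a_i=a_j\Leftrightarrow b_i=b_j$ for all $i,j\in[\ell]$. $[n]^\ell/_\sim$ is the set of equivalence classes. For $\gamma\in[n]^\ell/_\sim$, $B^\gamma\in\mathbb{R}^{n^\ell}$ is the tensor with $B^\gamma_a=1$ if $a\in\gamma$ and $B^\gamma_a=0$ otherwise. $\mathrm{b}(\ell)$ is the $\ell$-th Bell number, the number of partitions of a set with $\ell$ elements. $[n]^k\times[n]^k$ is identified with $[n]^{2k}$ by concatenation.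
   Formalization: The dimension formulas b(k) and b(2k) are asserted only for k ≤ n and 2k ≤ n respectively, since they fail otherwise (e.g. n=1, k=2: dimension 1, b(2)=2); the basis claims are for all k, n ≥ 1. *)

theory Defs
  imports "HOL-Analysis.Analysis" "HOL-Library.Function_Algebras" "HOL-Library.Disjoint_Sets"
begin

(* The pointwise real vector space structure on functions.  It makes the sets of linear maps
   below subsets of a real vector space, so that dim, span and independent apply to them. *)

instantiation "fun" :: (type, real_vector) real_vector
begin

definition scaleR_fun :: "real \<Rightarrow> ('a \<Rightarrow> 'b) \<Rightarrow> 'a \<Rightarrow> 'b" where
  "scaleR_fun c f = (\<lambda>x. c *\<^sub>R f x)"

instance
  by standard (simp_all add: scaleR_fun_def fun_eq_iff scaleR_add_right scaleR_add_left)

end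

(* The type 'n plays the role of [n] with n = CARD('n), and 'k that of the set of k tensor
   positions with k = CARD('k).  Multi-indices are functions 'k => 'n; multi-indices of length 2k
   are functions 'k + 'k => 'n, and the concatenation of a and b is case_sum a b. *)

type_synonym ('n, 'k) tensor = "real ^ ('k \<Rightarrow> 'n)"

definition reorder :: "('n \<Rightarrow> 'n) \<Rightarrow> ('n::finite, 'k::finite) tensor \<Rightarrow> ('n, 'k) tensor" where
  "reorder p A = (\<chi> a. A $ (inv p \<circ> a))"

lemma reorder_nth:
  assumes "bij p"
  shows "reorder p A $ (p \<circ> a) = A $ a"
  using assms by (simp add: reorder_def bij_is_inj flip: comp_assoc)

definition invariant_maps :: "(('n::finite, 'k::finite) tensor \<Rightarrow> real) set" where
  "invariant_maps = {L. linear L \<and> (\<forall>p. bij p \<longrightarrow> (\<forall>A. L (reorder p A) = L A))}"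

definition equivariant_maps ::
    "(('n::finite, 'k::finite) tensor \<Rightarrow> ('n, 'k) tensor) set" where
  "equivariant_maps =
     {L. linear L \<and> (\<forall>p. bij p \<longrightarrow> (\<forall>A. L (reorder p A) = reorder p (L A)))}"

definition same_pattern :: "(('l \<Rightarrow> 'n) \<times> ('l \<Rightarrow> 'n)) set" where
  "same_pattern = {(a, b). \<forall>i j. a i = a j \<longleftrightarrow> b i = b j}"

lemma equiv_same_pattern: "equiv UNIV same_pattern"
  by (auto simp: same_pattern_def equiv_def refl_on_def sym_def trans_def)

definition pattern_classes :: "('l \<Rightarrow> 'n) set set" where
  "pattern_classes = UNIV // same_pattern"

definition pattern_tensor :: "('l \<Rightarrow> 'n) set \<Rightarrow> ('n::finite, 'l::finite) tensor" where
  "pattern_tensor \<gamma> = (\<chi> a. if a \<in> \<gamma> then 1 else 0)"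

definition functional_of :: "('n::finite, 'k::finite) tensor \<Rightarrow> ('n, 'k) tensor \<Rightarrow> real" where
  "functional_of B = (\<lambda>A. \<Sum>a\<in>UNIV. B $ a * A $ a)"

definition operator_of ::
    "('n::finite, 'k::finite + 'k) tensor \<Rightarrow> ('n, 'k) tensor \<Rightarrow> ('n, 'k) tensor" where
  "operator_of B = (\<lambda>A. \<chi> b. \<Sum>a\<in>UNIV. B $ case_sum a b * A $ a)"

definition basis_family :: "('i \<Rightarrow> 'v::real_vector) \<Rightarrow> 'i set \<Rightarrow> 'v set \<Rightarrow> bool" where
  "basis_family f I V \<longleftrightarrow> inj_on f I \<and> independent (f ` I) \<and> span (f ` I) = V"

(* Equality patterns in [n]^l correspond to partitions of {1..l} into at most n blocks, so there
   are bell l of them exactly when l <= n. *)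

definition bell :: "nat \<Rightarrow> nat" where
  "bell l = card {P. partition_on {1..l} P}"

end

theory Submission
  imports Defs
begin

(* Identifying tensors with linear maps turns invariance and equivariance into invariance of the
   representing tensor under all reorderings.  Two multi-indices lie in one orbit of the symmetric
   group iff they have the same equality pattern, so the fixed tensors are those constant on pattern
   classes, and the orbit indicators are an orthogonal basis of them.  A pattern is the partition of
   the positions into level sets, which gives the Bell number as soon as n is large enough for
   every partition to occur. *)

section \<open>Bases and linear images\<close>

text \<open>This transports the basis of fixed tensors to the spaces of linear maps: a linear map
  commutes with \<open>span\<close>, and injectivity preserves independence and keeps the indexed
  vectors distinct.\<close>

lemma basis_family_image:
  fixes T :: "'v::real_vector \<Rightarrow> 'w::real_vector"
  assumes "basis_family f I V" "linear T" "inj T"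
  shows "basis_family (\<lambda>i. T (f i)) I (T ` V)"
proof -
  have "inj_on (T \<circ> f) I"
    using assms by (intro comp_inj_on) (auto simp: basis_family_def intro: inj_on_subset)
  moreover have "independent (T ` f ` I)"
    using assms
    by (intro linear_independent_injective_image) (auto simp: basis_family_def intro: inj_on_subset)
  moreover have "span (T ` f ` I) = T ` V"
    using assms linear_span_image[of T "f ` I"] by (simp add: basis_family_def)
  ultimately show ?thesis
    by (simp add: basis_family_def image_image comp_def)
qed

lemma dim_basis_family:
  assumes "basis_family f I V"
  shows "dim V = card I"
  using assms unfolding basis_family_def
  by (metis card_image dim_eq_card_independent dim_span)

section \<open>Orbits of multi-indices and fixed tensors\<close>

text \<open>Equinumerous subsets of a finite type have equinumerous complements, so any bijection
  between the complements can be glued on.\<close>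

lemma bij_betw_extend_UNIV:
  fixes f :: "'a::finite \<Rightarrow> 'a"
  assumes "bij_betw f A B"
  obtains p where "bij p" "\<And>x. x \<in> A \<Longrightarrow> p x = f x"
proof -
  have "card (- A) = card (- B)"
    using bij_betw_same_card[OF assms] by (simp add: Compl_eq_Diff_UNIV card_Diff_subset)
  then obtain h where h: "bij_betw h (- A) (- B)"
    using finite_same_card_bij[of "- A" "- B"] by auto
  define p where "p x = (if x \<in> A then f x else h x)" for x
  have "bij_betw p A B" "bij_betw p (- A) (- B)"
    using assms h bij_betw_cong[of A p f B] bij_betw_cong[of "- A" p h "- B"] by (simp_all add: p_def)
  then have "bij_betw p (A \<union> - A) (B \<union> - B)"
    by (rule bij_betw_combine) simp
  then show thesis
    by (intro that[of p]) (simp_all add: p_def)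
qed

lemma same_pattern_iff:
  fixes a b :: "'l \<Rightarrow> 'n::finite"
  shows "(a, b) \<in> same_pattern \<longleftrightarrow> (\<exists>p. bij p \<and> b = p \<circ> a)"
proof
  assume ab: "(a, b) \<in> same_pattern"
  \<comment> \<open>\<open>f\<close> relabels the values of \<open>a\<close> as those of
    \<open>b\<close>. \<open>inv a\<close> picks some position carrying the value; since equal
    values of \<open>a\<close> force equal values of \<open>b\<close>, the choice is
    irrelevant.\<close>
  define f where "f x = b (inv a x)" for x
  have f: "f (a i) = b i" for i
    using ab f_inv_into_f[of "a i" a UNIV] unfolding f_def same_pattern_def by auto
  \<comment> \<open>Injectivity is the other direction of the pattern: equal values of
    \<open>b\<close> force equal values of \<open>a\<close>.\<close>
  have "bij_betw f (range a) (range b)"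
    using ab by (auto simp: bij_betw_def inj_on_def f image_image same_pattern_def)
  then obtain p where p: "bij p" "\<And>x. x \<in> range a \<Longrightarrow> p x = f x"
    by (rule bij_betw_extend_UNIV) blast
  then have "b = p \<circ> a"
    by (auto simp: f)
  with p(1) show "\<exists>p. bij p \<and> b = p \<circ> a"
    by blast
qed (auto simp: same_pattern_def bij_def inj_eq)

lemma reorder_eq_iff:
  fixes A B :: "('n::finite, 'l::finite) tensor"
  assumes "bij p"
  shows "reorder p A = B \<longleftrightarrow> (\<forall>a. A $ a = B $ (p \<circ> a))"
proof
  assume "\<forall>a. A $ a = B $ (p \<circ> a)"
  moreover have "p \<circ> (inv p \<circ> a) = a" for a :: "'l \<Rightarrow> 'n"
    using assms by (auto simp: fun_eq_iff bij_is_surj surj_f_inv_f)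
  ultimately show "reorder p A = B"
    by (simp add: reorder_def vec_eq_iff)
qed (auto simp: reorder_nth[OF assms])

text \<open>The position type is arbitrary, so that \<open>'k\<close> serves the functionals and
  \<open>'k + 'k\<close> the operators.\<close>

definition fixed_tensors :: "('n::finite, 'l::finite) tensor set" where
  "fixed_tensors = {B. \<forall>p. bij p \<longrightarrow> reorder p B = B}"

lemma fixed_tensors_iff_comp:
  "B \<in> fixed_tensors \<longleftrightarrow> (\<forall>p. bij p \<longrightarrow> (\<forall>a. B $ a = B $ (p \<circ> a)))"
  by (simp add: fixed_tensors_def reorder_eq_iff)

lemma fixed_tensors_iff:
  "B \<in> fixed_tensors \<longleftrightarrow> (\<forall>a b. (a, b) \<in> same_pattern \<longrightarrow> B $ a = B $ b)"
  unfolding fixed_tensors_iff_comp same_pattern_iff by blast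

lemma fixed_tensors_eq_sum:
  fixes B :: "('n::finite, 'l::finite) tensor"
  assumes "B \<in> fixed_tensors"
  shows "B = (\<Sum>\<gamma>\<in>pattern_classes. B $ (SOME a. a \<in> \<gamma>) *\<^sub>R pattern_tensor \<gamma>)"
proof -
  \<comment> \<open>The coefficient is the value of \<open>B\<close> at a chosen representative; as
    \<open>B\<close> is constant on classes, any choice gives the same value.\<close>
  let ?c = "\<lambda>\<gamma>. B $ (SOME a. a \<in> \<gamma>)"
  have "(\<Sum>\<gamma>\<in>pattern_classes. ?c \<gamma> *\<^sub>R pattern_tensor \<gamma>) $ a = B $ a" for a
  proof -
    define \<alpha> where "\<alpha> = same_pattern `` {a}"
    have a: "a \<in> \<alpha>"
      by (simp add: \<alpha>_def same_pattern_def)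
    have \<alpha>: "\<alpha> \<in> pattern_classes"
      by (simp add: \<alpha>_def pattern_classes_def quotientI)
    \<comment> \<open>Classes are disjoint, so only the summand of \<alpha> survives in entry
      \<open>a\<close>.\<close>
    have mem: "a \<in> \<gamma> \<longleftrightarrow> \<gamma> = \<alpha>" if "\<gamma> \<in> pattern_classes" for \<gamma>
      using quotient_disj[OF equiv_same_pattern, of \<gamma> \<alpha>] that \<alpha> a
      by (auto simp: pattern_classes_def)
    have "(SOME b. b \<in> \<alpha>) \<in> \<alpha>"
      using a by (metis someI_ex)
    then have "?c \<alpha> = B $ a"
      using assms by (auto simp: fixed_tensors_iff \<alpha>_def)
    moreover have "(\<Sum>\<gamma>\<in>pattern_classes. ?c \<gamma> *\<^sub>R pattern_tensor \<gamma>) $ a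
        = (\<Sum>\<gamma>\<in>pattern_classes. if \<gamma> = \<alpha> then ?c \<gamma> else 0)"
      unfolding sum_component by (intro sum.cong refl) (simp add: pattern_tensor_def mem)
    ultimately show ?thesis
      using \<alpha> by simp
  qed
  then show ?thesis
    by (simp add: vec_eq_iff)
qed

lemma basis_family_pattern_tensor:
  "basis_family pattern_tensor pattern_classes (fixed_tensors :: ('n::finite, 'l::finite) tensor set)"
proof -
  let ?P = "pattern_tensor :: _ \<Rightarrow> ('n, 'l) tensor"
  \<comment> \<open>A class is recovered from its tensor. This yields injectivity, and also that the
    tensor of a nonempty class is nonzero.\<close>
  have support: "\<gamma> = {a. ?P \<gamma> $ a = 1}" for \<gamma>
    by (simp add: pattern_tensor_def)
  have inj: "inj_on ?P pattern_classes"
    by (metis support inj_onI)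
  have "orthogonal (?P \<gamma>) (?P \<delta>)"
    if "\<gamma> \<in> pattern_classes" "\<delta> \<in> pattern_classes" "\<gamma> \<noteq> \<delta>" for \<gamma> \<delta>
  proof -
    have "\<gamma> \<inter> \<delta> = {}"
      using quotient_disj[OF equiv_same_pattern, of \<gamma> \<delta>] that by (simp add: pattern_classes_def)
    then show ?thesis
      by (auto simp: orthogonal_def inner_vec_def pattern_tensor_def intro!: sum.neutral)
  qed
  then have "pairwise orthogonal (?P ` pattern_classes)"
    by (auto simp: pairwise_def)
  moreover have "0 \<notin> ?P ` pattern_classes"
  proof
    assume "0 \<in> ?P ` pattern_classes"
    then obtain \<gamma> where \<gamma>: "\<gamma> \<in> pattern_classes" "?P \<gamma> = 0"
      by auto
    then have "\<gamma> = {}"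
      using support[of \<gamma>] by simp
    then show False
      using \<gamma> in_quotient_imp_non_empty[OF equiv_same_pattern] by (auto simp: pattern_classes_def)
  qed
  ultimately have "independent (?P ` pattern_classes)"
    by (rule pairwise_orthogonal_independent)
  moreover have "span (?P ` pattern_classes) = fixed_tensors"
  proof
    have "?P \<gamma> \<in> fixed_tensors" if "\<gamma> \<in> pattern_classes" for \<gamma>
      using that unfolding fixed_tensors_iff pattern_tensor_def pattern_classes_def
      by (auto dest: in_quotient_imp_closed[OF equiv_same_pattern]
          intro: symE[OF equivE[OF equiv_same_pattern]])
    moreover have "subspace (fixed_tensors :: ('n, 'l) tensor set)"
      by (auto simp: subspace_def fixed_tensors_iff)
    ultimately show "span (?P ` pattern_classes) \<subseteq> fixed_tensors"
      by (intro span_minimal) auto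
    show "fixed_tensors \<subseteq> span (?P ` pattern_classes)"
    proof
      fix B :: "('n, 'l) tensor"
      assume B: "B \<in> fixed_tensors"
      show "B \<in> span (?P ` pattern_classes)"
        by (subst fixed_tensors_eq_sum[OF B]) (intro span_sum span_scale span_base imageI)
    qed
  qed
  ultimately show ?thesis
    using inj by (simp add: basis_family_def)
qed

section \<open>Tensors representing linear maps\<close>

lemma linear_expand_axis:
  fixes L :: "real ^ 'i::finite \<Rightarrow> 'v::real_vector"
  assumes "linear L"
  shows "L A = (\<Sum>a\<in>UNIV. A $ a *\<^sub>R L (axis a 1))"
proof -
  have "L A = L (\<Sum>a\<in>UNIV. A $ a *\<^sub>R axis a 1)"
    by (simp add: basis_expansion flip: scalar_mult_eq_scaleR)
  then show ?thesis
    using assms by (simp add: linear_sum linear_scale)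
qed

lemma sum_axis:
  fixes f :: "'i::finite \<Rightarrow> real"
  shows "(\<Sum>i\<in>UNIV. f i * axis a 1 $ i) = f a"
  by (simp add: axis_def if_distrib[of "(*) _"] cong: if_cong)

text \<open>Reindexing the sum along the bijection \<open>a\<close> to \<open>p \<circ> a\<close>
  moves the permutation from the tensor to the coefficients.\<close>

lemma sum_reorder:
  fixes f :: "('k::finite \<Rightarrow> 'n::finite) \<Rightarrow> real"
  assumes "bij p"
  shows "(\<Sum>a\<in>UNIV. f a * reorder p A $ a) = (\<Sum>a\<in>UNIV. f (p \<circ> a) * A $ a)"
proof -
  have "bij ((\<circ>) p :: ('k \<Rightarrow> 'n) \<Rightarrow> _)"
    using assms by (intro o_bij[of "(\<circ>) (inv p)"])
      (auto simp: fun_eq_iff bij_is_surj surj_f_inv_f bij_is_inj)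
  then have "(\<Sum>a\<in>UNIV. f (p \<circ> a) * reorder p A $ (p \<circ> a)) = (\<Sum>a\<in>UNIV. f a * reorder p A $ a)"
    by (intro sum.reindex_bij_betw)
  then show ?thesis
    by (simp add: reorder_nth[OF assms])
qed

section \<open>Functionals and the invariant case\<close>

lemma linear_functional_of_tensor: "linear functional_of"
  by (intro linearI ext)
    (simp_all add: functional_of_def scaleR_fun_def distrib_right sum.distrib sum_distrib_left
      mult.assoc)

lemma functional_of_axis: "functional_of B (axis a 1) = B $ a"
  by (simp add: functional_of_def sum_axis)

lemma inj_functional_of: "inj functional_of"
proof (rule injI)
  fix B C :: "('n::finite, 'k::finite) tensor"
  assume "functional_of B = functional_of C"
  then show "B = C"
    by (simp add: vec_eq_iff flip: functional_of_axis)
qed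

lemma linear_functional_of: "linear (functional_of B)"
  by (intro linearI)
    (simp_all add: functional_of_def distrib_left sum.distrib sum_distrib_left mult.left_commute)

lemma functional_of_surj:
  assumes "linear L"
  obtains B where "L = functional_of B"
proof
  \<comment> \<open>The witness is forced: by \<open>functional_of_axis\<close>, evaluation at unit
    tensors reads off the entries.\<close>
  show "L = functional_of (\<chi> a. L (axis a 1))"
    by (rule ext, subst linear_expand_axis[OF assms]) (simp add: functional_of_def mult.commute)
qed

text \<open>The adjoint form of the action: reordering the argument by \<open>p\<close> amounts to
  reordering the representing tensor by \<open>inv p\<close>.\<close>

lemma functional_of_reorder:
  assumes "bij p"
  shows "functional_of B (reorder p A) = functional_of (\<chi> a. B $ (p \<circ> a)) A"
  by (simp add: functional_of_def sum_reorder[OF assms])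

lemma functional_of_invariant_iff: "functional_of B \<in> invariant_maps \<longleftrightarrow> B \<in> fixed_tensors"
proof -
  have "functional_of B \<in> invariant_maps
      \<longleftrightarrow> (\<forall>p. bij p \<longrightarrow> functional_of B = functional_of (\<chi> a. B $ (p \<circ> a)))"
    by (simp add: invariant_maps_def linear_functional_of functional_of_reorder fun_eq_iff
        eq_commute[of "functional_of B A" for A])
  also have "\<dots> \<longleftrightarrow> B \<in> fixed_tensors"
    by (simp add: inj_eq[OF inj_functional_of] fixed_tensors_iff_comp vec_eq_iff)
  finally show ?thesis .
qed

lemma functional_of_fixed_tensors: "functional_of ` fixed_tensors = invariant_maps"
proof
  show "invariant_maps \<subseteq> functional_of ` fixed_tensors"
  proof
    fix L :: "('n::finite, 'k::finite) tensor \<Rightarrow> real"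
    assume L: "L \<in> invariant_maps"
    then have "linear L"
      by (simp add: invariant_maps_def)
    then obtain B where "L = functional_of B"
      by (rule functional_of_surj)
    with L show "L \<in> functional_of ` fixed_tensors"
      by (simp add: functional_of_invariant_iff)
  qed
qed (auto simp: functional_of_invariant_iff)

section \<open>Operators and the equivariant case\<close>

lemma linear_operator_of_tensor: "linear operator_of"
  by (intro linearI ext)
    (simp_all add: operator_of_def vec_eq_iff scaleR_fun_def distrib_right sum.distrib
      sum_distrib_left mult.assoc)

lemma operator_of_axis: "operator_of B (axis a 1) $ b = B $ case_sum a b"
  by (simp add: operator_of_def sum_axis)

lemma inj_operator_of: "inj operator_of"
proof (rule injI)
  fix B C :: "('n::finite, 'k::finite + 'k) tensor"
  assume "operator_of B = operator_of C"
  \<comment> \<open>Every \<open>c\<close> is the concatenation of its two halves, so values at unit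
    tensors reach all entries.\<close>
  then have "B $ case_sum (c \<circ> Inl) (c \<circ> Inr) = C $ case_sum (c \<circ> Inl) (c \<circ> Inr)" for c
    by (simp only: flip: operator_of_axis)
  then show "B = C"
    by (simp add: vec_eq_iff comp_def surjective_sum)
qed

lemma linear_operator_of: "linear (operator_of B)"
  by (intro linearI)
    (simp_all add: operator_of_def vec_eq_iff distrib_left sum.distrib sum_distrib_left
      mult.left_commute)

lemma operator_of_surj:
  assumes "linear L"
  obtains B where "L = operator_of B"
proof
  show "L = operator_of (\<chi> c. L (axis (c \<circ> Inl) 1) $ (c \<circ> Inr))"
    by (rule ext, subst linear_expand_axis[OF assms])
      (simp add: operator_of_def vec_eq_iff mult.commute case_sum_o_inj)
qed

text \<open>Reindexing the sum puts \<open>p\<close> on the input half, and comparing entries at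
  \<open>p \<circ> b\<close> puts it on the output half. Together \<open>p\<close> acts on the whole
  multi-index of length 2k, so equivariance of the operator becomes invariance of its
  tensor.\<close>

lemma operator_of_reorder_iff:
  assumes "bij p"
  shows "operator_of B (reorder p A) = reorder p (operator_of B A)
    \<longleftrightarrow> operator_of B A = operator_of (\<chi> c. B $ (p \<circ> c)) A"
proof -
  have "operator_of B (reorder p A) = reorder p (operator_of B A)
      \<longleftrightarrow> (\<forall>b. operator_of B A $ b = operator_of B (reorder p A) $ (p \<circ> b))"
    by (subst eq_commute) (rule reorder_eq_iff[OF assms])
  then show ?thesis
    by (simp add: operator_of_def sum_reorder[OF assms] vec_eq_iff o_case_sum)
qed

lemma operator_of_equivariant_iff: "operator_of B \<in> equivariant_maps \<longleftrightarrow> B \<in> fixed_tensors"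
proof -
  have "operator_of B \<in> equivariant_maps
      \<longleftrightarrow> (\<forall>p. bij p \<longrightarrow> operator_of B = operator_of (\<chi> c. B $ (p \<circ> c)))"
    by (simp add: equivariant_maps_def linear_operator_of operator_of_reorder_iff fun_eq_iff)
  also have "\<dots> \<longleftrightarrow> B \<in> fixed_tensors"
    by (simp add: inj_eq[OF inj_operator_of] fixed_tensors_iff_comp vec_eq_iff)
  finally show ?thesis .
qed

lemma operator_of_fixed_tensors: "operator_of ` fixed_tensors = equivariant_maps"
proof
  show "equivariant_maps \<subseteq> operator_of ` fixed_tensors"
  proof
    fix L :: "('n::finite, 'k::finite) tensor \<Rightarrow> ('n, 'k) tensor"
    assume L: "L \<in> equivariant_maps"
    then have "linear L"
      by (simp add: equivariant_maps_def)
    then obtain B where "L = operator_of B"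
      by (rule operator_of_surj)
    with L show "L \<in> operator_of ` fixed_tensors"
      by (simp add: operator_of_equivariant_iff)
  qed
qed (auto simp: operator_of_equivariant_iff)

section \<open>Counting patterns\<close>

text \<open>Taking images of blocks maps partitions injectively to partitions. An inequality
  suffices, since it is applied to a bijection and to its inverse.\<close>

lemma card_partitions_le:
  assumes "bij_betw f A B" "finite B"
  shows "card {P. partition_on A P} \<le> card {P. partition_on B P}"
proof (rule card_inj_on_le)
  have "inj_on ((`) ((`) f)) (Pow (Pow A))"
    using assms by (intro inj_on_image_Pow) (simp add: bij_betw_def)
  then show "inj_on ((`) ((`) f)) {P. partition_on A P}"
    by (rule inj_on_subset) (auto simp: partition_on_def)
  show "(`) ((`) f) ` {P. partition_on A P} \<subseteq> {P. partition_on B P}"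
  proof clarify
    fix P assume P: "partition_on A P"
    \<comment> \<open>\<open>partition_on_inj_image\<close> removes the empty set from the image;
      blocks are nonempty, so nothing is lost.\<close>
    then have "(`) f ` P - {{}} = (`) f ` P"
      by (auto simp: partition_on_def)
    then show "partition_on B ((`) f ` P)"
      using partition_on_inj_image[OF P, of f] assms by (simp add: bij_betw_def)
  qed
qed (use assms finitely_many_partition_on in blast)

lemma card_partitions_eq_bell: "card {P. partition_on (UNIV :: 'l::finite set) P} = bell CARD('l)"
proof -
  obtain f :: "'l \<Rightarrow> nat" where f: "bij_betw f UNIV {1..CARD('l)}"
    using finite_same_card_bij[of "UNIV :: 'l set" "{1..CARD('l)}"] by auto
  show ?thesis
    unfolding bell_def
    using card_partitions_le[OF f] card_partitions_le[OF bij_betw_inv_into[OF f]]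
    by (intro antisym) auto
qed

definition level_sets :: "('l \<Rightarrow> 'n) \<Rightarrow> 'l set set" where
  "level_sets a = range (\<lambda>i. {j. a j = a i})"

lemma partition_on_level_sets: "partition_on UNIV (level_sets a)"
  by (rule partition_onI) (auto simp: level_sets_def disjnt_def)

lemma level_sets_eq_iff: "level_sets a = level_sets b \<longleftrightarrow> (a, b) \<in> same_pattern"
proof
  \<comment> \<open>The equality pattern can be read off the partition alone: equal values mean a
    common block.\<close>
  have block: "(\<exists>p\<in>level_sets c. i \<in> p \<and> j \<in> p) \<longleftrightarrow> c i = c j" for c :: "'a \<Rightarrow> 'b" and i j
    by (auto simp: level_sets_def)
  assume "level_sets a = level_sets b"
  then have "a i = a j \<longleftrightarrow> b i = b j" for i j
    using block[of a i j] block[of b i j] by simp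
  then show "(a, b) \<in> same_pattern"
    by (simp add: same_pattern_def)
qed (auto simp: same_pattern_def level_sets_def)

text \<open>Send each position to its block and give the blocks distinct values in
  \<open>'n\<close>. There are at most \<open>CARD('l)\<close> blocks, so the size condition
  supplies enough values.\<close>

lemma level_sets_surj:
  fixes P :: "'l::finite set set"
  assumes P: "partition_on UNIV P" and "CARD('l) \<le> CARD('n::finite)"
  obtains a :: "'l \<Rightarrow> 'n::finite" where "level_sets a = P"
proof -
  have "\<forall>i. \<exists>p. p \<in> P \<and> i \<in> p"
    using P by (auto simp: partition_on_def)
  then obtain block where block: "\<And>i. block i \<in> P" "\<And>i. i \<in> block i"
    by metis
  have unique: "block i = p" if "p \<in> P" "i \<in> p" for i p
    using P block[of i] that by (auto simp: partition_on_def disjoint_def)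
  have range: "range block = P"
  proof
    show "P \<subseteq> range block"
    proof
      fix p assume "p \<in> P"
      moreover from this obtain i where "i \<in> p"
        using partition_onD3[OF P] by (metis ex_in_conv)
      ultimately show "p \<in> range block"
        using unique by blast
    qed
  qed (use block in auto)
  have "card P \<le> CARD('n)"
    using card_image_le[of "UNIV :: 'l set" block] assms(2) range by simp
  then obtain g :: "'l set \<Rightarrow> 'n" where g: "inj_on g P"
    using card_le_inj[of P "UNIV :: 'n set"] by auto
  have "{j. g (block j) = g (block i)} = block i" for i
    using inj_on_eq_iff[OF g] block unique by blast
  then have "level_sets (g \<circ> block) = P"
    using range by (simp add: level_sets_def)
  then show thesis
    by (rule that)
qed

lemma card_pattern_classes:
  assumes "CARD('l::finite) \<le> CARD('n::finite)"
  shows "card (pattern_classes :: ('l::finite \<Rightarrow> 'n::finite) set set) = bell CARD('l)"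
proof -
  let ?K = "level_sets :: ('l \<Rightarrow> 'n) \<Rightarrow> _"
  \<comment> \<open>The classes are the nonempty fibres of \<open>level_sets\<close>, hence as many
    as its values.\<close>
  have classes: "pattern_classes = (\<lambda>P. ?K -` {P}) ` range ?K"
    by (auto simp: pattern_classes_def quotient_def image_image vimage_def Image_def
        simp flip: level_sets_eq_iff)
  have inj: "inj_on (\<lambda>P. ?K -` {P}) (range ?K)"
    by (rule inj_onI) auto
  have "card (pattern_classes :: ('l \<Rightarrow> 'n) set set) = card (range ?K)"
    unfolding classes by (rule card_image[OF inj])
  also have "range ?K = {P. partition_on UNIV P}"
    by (auto simp: partition_on_level_sets elim: level_sets_surj[OF _ assms])
  finally show ?thesis
    by (simp add: card_partitions_eq_bell)
qed

theorem theorem1: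
  shows
    "(basis_family (\<lambda>\<gamma>. functional_of (pattern_tensor \<gamma>)) pattern_classes
        (invariant_maps :: (('n::finite, 'k::finite) tensor \<Rightarrow> real) set) \<and>
      (CARD('k) \<le> CARD('n) \<longrightarrow>
        dim (invariant_maps :: (('n, 'k) tensor \<Rightarrow> real) set) = bell CARD('k))) \<and>
     (basis_family (\<lambda>\<gamma>. operator_of (pattern_tensor \<gamma>)) pattern_classes
        (equivariant_maps :: (('n, 'k) tensor \<Rightarrow> ('n, 'k) tensor) set) \<and>
      (2 * CARD('k) \<le> CARD('n) \<longrightarrow>
        dim (equivariant_maps :: (('n, 'k) tensor \<Rightarrow> ('n, 'k) tensor) set) =
          bell (2 * CARD('k))))"
proof -
  have inv: "basis_family (\<lambda>\<gamma>. functional_of (pattern_tensor \<gamma>)) pattern_classes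
      (invariant_maps :: (('n, 'k) tensor \<Rightarrow> real) set)"
    using basis_family_image[OF basis_family_pattern_tensor linear_functional_of_tensor
        inj_functional_of]
    by (simp add: functional_of_fixed_tensors)
  have equi: "basis_family (\<lambda>\<gamma>. operator_of (pattern_tensor \<gamma>)) pattern_classes
      (equivariant_maps :: (('n, 'k) tensor \<Rightarrow> ('n, 'k) tensor) set)"
    using basis_family_image[OF basis_family_pattern_tensor linear_operator_of_tensor
        inj_operator_of]
    by (simp add: operator_of_fixed_tensors)
  \<comment> \<open>The tensors of the equivariant case have position type \<open>'k + 'k\<close>;
    its size turns the general count into the one for length 2k.\<close>
  have "CARD('k + 'k) = 2 * CARD('k)"
    by (simp add: card_Plus flip: UNIV_Plus_UNIV)
  then show ?thesis
    using inv equi card_pattern_classes[where 'l='k and 'n='n]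
      card_pattern_classes[where 'l="'k + 'k" and 'n='n]
    by (simp add: dim_basis_family mult_2)
qed

end
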